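(* Let $\langle X,(A_i)_{i\in X},p,r,\gamma\rangle$ be a finite Markov Decision Process with $n$ states, a total of $m$ actions, and discount factor $\gamma\in(0,1)$. Then Simplex-PI (started from any policy) terminates after at most $$n(m-n)\left(1+\frac{2}{1-\gamma}\log\frac{1}{1-\gamma}\right)=O\left(\frac{mn}{1-\gamma}\log\frac{1}{1-\gamma}\right)$$ iterations.
   Context: A finite Markov Decision Process (MDP) consists of a state space $X=\{1,\dots,n\}$; a finite action space $A$ of size $m$, partitioned into nonempty sets $A_i$ ($i\in X$), where $A_i$ is the set of admissible actions in state $i$; transition probabilities $p_{ij}(a)=\mathbb{P}(i_{t+1}=j\mid i_t=i,a_t=a)$ for $a\in A_i$; a reward function $r(i,a,j)\in\mathbb{R}$; and a discount factor $\gamma\in(0,1)$. A policy is a map $\pi:X\to A$ with $\pi(i)\in A_i$ for all $i$. Let $P_\pi$ be the $n\times n$ stochastic matrix with entries $p_{ij}(\pi(i))$ and $r_\pi$ the vector with components $\sum_j p_{ij}(\pi(i))r(i,\pi(i),j)$. The operator $T_\pi$ is $T_\pi v=r_\pi+\gamma P_\pi v$, and the value $v_\pi\in\mathbb{R}^n$ of $\pi$ is its unique fixed point (the expected $\gamma$-discounted sum of rewards). The optimal value is $v_*=\max_\pi v_\pi$ (componentwise); a policy is optimal if its value is $v_*$. Let $Tv=\max_\pi T_\pi v$ (componentwise); a policy $\pi$ is greedy with respect to $v$ if $T_\pi v=Tv$, and $\mathcal{G}(v)$ denotes any such policy. The maximal advantage with respect to $\pi$ is $a_\pi=Tv_\pi-v_\pi\ge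 0$, and $S_\pi=\{i: a_\pi(i)>0\}$ is the set of switchable states; $\pi$ is optimal iff $S_\pi=\emptyset$. For nonempty $Y\subseteq S_\pi$, $\mathrm{switch}(\pi,Y)$ is the policy equal to $\mathcal{G}(v_\pi)(i)$ for $i\in Y$ and to $\pi(i)$ for $i\notin Y$. Simplex-PI generates, from an initial policy $\pi_0$, the sequence $\pi_{k+1}=\mathrm{switch}(\pi_k,\{i_k\})$ where $i_k\in\arg\max_i a_{\pi_k}(i)$ (it switches only the action in one state of maximal advantage). It terminates when $\pi_k$ is optimal; one iteration is one update $\pi_k\to\pi_{k+1}$. $\log$ is the natural logarithm. *)

theory Defs
  imports "HOL-Analysis.Analysis" "HOL-Library.Landau_Symbols"
begin

text \<open>
  The states are the elements of a finite type, so that value functions are vectors in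
  \<open>real ^ 's\<close>. The conditions on \<open>p i j a\<close> are only imposed for admissible actions \<open>a \<in> A i\<close>.
  The rewards \<open>r\<close> are unconstrained, so the locale predicate does not take them as an argument.
\<close>

locale finite_mdp =
  fixes Act :: "'a set"
    and A :: "'s::finite \<Rightarrow> 'a set"
    and p :: "'s \<Rightarrow> 's \<Rightarrow> 'a \<Rightarrow> real"
    and r :: "'s \<Rightarrow> 'a \<Rightarrow> 's \<Rightarrow> real"
    and \<gamma> :: real
  assumes finite_Act: "finite Act"
    and A_nonempty: "A i \<noteq> {}"
    and A_disjoint: "disjoint_family A"
    and A_union: "(\<Union>i. A i) = Act"
    and p_nonneg: "a \<in> A i \<Longrightarrow> 0 \<le> p i j a"
    and p_sum: "a \<in> A i \<Longrightarrow> (\<Sum>j\<in>UNIV. p i j a) = 1"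
    and discount: "0 < \<gamma>" "\<gamma> < 1"
begin

definition policies :: "('s \<Rightarrow> 'a) set" where
  "policies = {\<pi>. \<forall>i. \<pi> i \<in> A i}"

definition P_pol :: "('s \<Rightarrow> 'a) \<Rightarrow> real ^ 's ^ 's" where
  "P_pol \<pi> = (\<chi> i j. p i j (\<pi> i))"

definition r_pol :: "('s \<Rightarrow> 'a) \<Rightarrow> real ^ 's" where
  "r_pol \<pi> = (\<chi> i. \<Sum>j\<in>UNIV. p i j (\<pi> i) * r i (\<pi> i) j)"

definition T_pol :: "('s \<Rightarrow> 'a) \<Rightarrow> real ^ 's \<Rightarrow> real ^ 's" where
  "T_pol \<pi> v = r_pol \<pi> + \<gamma> *\<^sub>R (P_pol \<pi> *v v)"

definition val :: "('s \<Rightarrow> 'a) \<Rightarrow> real ^ 's" where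
  "val \<pi> = (THE v. T_pol \<pi> v = v)"

definition opt_val :: "real ^ 's" where
  "opt_val = (\<chi> i. Max ((\<lambda>\<pi>. val \<pi> $ i) ` policies))"

definition optimal :: "('s \<Rightarrow> 'a) \<Rightarrow> bool" where
  "optimal \<pi> \<longleftrightarrow> \<pi> \<in> policies \<and> val \<pi> = opt_val"

definition T_opt :: "real ^ 's \<Rightarrow> real ^ 's" where
  "T_opt v = (\<chi> i. Max ((\<lambda>\<pi>. T_pol \<pi> v $ i) ` policies))"

definition greedy :: "('s \<Rightarrow> 'a) \<Rightarrow> real ^ 's \<Rightarrow> bool" where
  "greedy \<pi> v \<longleftrightarrow> \<pi> \<in> policies \<and> T_pol \<pi> v = T_opt v"

definition advantage :: "('s \<Rightarrow> 'a) \<Rightarrow> real ^ 's" where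
  "advantage \<pi> = T_opt (val \<pi>) - val \<pi>"

text \<open>
  The argument \<open>g\<close> is the greedy policy used for the switch; it is an explicit argument because
  greedy policies need not be unique.
\<close>

definition switch :: "('s \<Rightarrow> 'a) \<Rightarrow> ('s \<Rightarrow> 'a) \<Rightarrow> 's set \<Rightarrow> 's \<Rightarrow> 'a" where
  "switch g \<pi> Y = (\<lambda>i. if i \<in> Y then g i else \<pi> i)"

text \<open>
  The step is a relation: ties between states of maximal advantage and between greedy policies
  may be resolved arbitrarily, and independently at every iteration.
\<close>

definition simplex_step :: "('s \<Rightarrow> 'a) \<Rightarrow> ('s \<Rightarrow> 'a) \<Rightarrow> bool" where
  "simplex_step \<pi> \<pi>' \<longleftrightarrow>
    (\<exists>g i. greedy g (val \<pi>) \<and> is_arg_max (\<lambda>j. advantage \<pi> $ j) (\<lambda>_. True) i \<and>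
           \<pi>' = switch g \<pi> {i})"

text \<open>
  A run is padded to an infinite sequence by repeating the policy at which it has terminated.
  Its number of iterations is therefore the least index of an optimal policy.
\<close>

definition simplex_PI_run :: "(nat \<Rightarrow> 's \<Rightarrow> 'a) \<Rightarrow> bool" where
  "simplex_PI_run \<pi>s \<longleftrightarrow> \<pi>s 0 \<in> policies \<and>
    (\<forall>k. if optimal (\<pi>s k) then \<pi>s (Suc k) = \<pi>s k else simplex_step (\<pi>s k) (\<pi>s (Suc k)))"

definition terminates :: "(nat \<Rightarrow> 's \<Rightarrow> 'a) \<Rightarrow> bool" where
  "terminates \<pi>s \<longleftrightarrow> (\<exists>k. optimal (\<pi>s k))"

definition iterations :: "(nat \<Rightarrow> 's \<Rightarrow> 'a) \<Rightarrow> nat" where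
  "iterations \<pi>s = (LEAST k. optimal (\<pi>s k))"

end

definition simplex_PI_bound :: "nat \<Rightarrow> nat \<Rightarrow> real \<Rightarrow> real" where
  "simplex_PI_bound n m \<gamma> =
    real n * (real m - real n) * (1 + 2 / (1 - \<gamma>) * ln (1 / (1 - \<gamma>)))"

text \<open>
  The domain of the asymptotic statement: the implied constant is uniform in \<open>n\<close>, \<open>m\<close> and
  \<open>\<gamma> \<in> [\<gamma>0, 1)\<close>. A lower bound \<open>\<gamma>0 > 0\<close> is unavoidable, since \<open>ln (1 / (1 - \<gamma>))\<close> tends to \<open>0\<close>
  for \<open>\<gamma> \<rightarrow> 0\<close> whereas the bound above tends to \<open>n * (m - n)\<close>.
\<close>

definition mdp_sizes :: "real \<Rightarrow> (nat \<times> nat \<times> real) set" where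
  "mdp_sizes \<gamma>0 = {(n, m, \<gamma>). 1 \<le> n \<and> n \<le> m \<and> \<gamma>0 \<le> \<gamma> \<and> \<gamma> < 1}"

end

theory Submission
  imports Defs
begin

text \<open>
  When Simplex-PI switches state \<open>s\<close>, the value at \<open>s\<close> increases by at least the maximal
  advantage, which is at least \<open>1 - \<gamma>\<close> times the maximal distance \<open>\<Delta>\<close> to the optimal value.
  Hence the distance at \<open>s\<close> shrinks by a factor \<open>\<gamma>\<close> at every switch of \<open>s\<close>, and at the moment
  of a switch it is at least \<open>(1 - \<gamma>) \<Delta>\<close>. Among \<open>n * Q + 1\<close> consecutive switches some state
  occurs \<open>Q + 1\<close> times, so \<open>\<Delta>\<close> shrinks by a factor \<open>\<gamma> ^ Q / (1 - \<gamma>)\<close>.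
  The gap of an action is its loss in the Bellman equation of the optimal value. The gaps of the
  actions of a policy are at most \<open>\<Delta>\<close>, and \<open>\<Delta>\<close> is at most \<open>1 / (1 - \<gamma>)\<close> times the
  largest of them. If \<open>\<gamma> ^ Q < (1 - \<gamma>)\<^sup>2\<close>, the action of largest gap therefore never occurs
  again after \<open>n * Q\<close> iterations. As at most \<open>m - n\<close> actions have a positive gap, there are at
  most \<open>(m - n) * n * Q\<close> iterations.
\<close>

text \<open>Pigeonhole: \<open>{..CARD('s) * Q}\<close> has one element more than
  \<open>CARD('s)\<close> classes of size at most \<open>Q\<close> can cover.\<close>

lemma ex_frequent_value:
  fixes f :: "nat \<Rightarrow> 's::finite"
  shows "\<exists>s. Q < card {t \<in> {..CARD('s) * Q}. f t = s}"
proof (rule ccontr)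
  assume "\<not> ?thesis"
  then have le: "card {t \<in> {..CARD('s) * Q}. f t = s} \<le> Q" for s
    by (simp add: not_less)
  have "{..CARD('s) * Q} = (\<Union>s. {t \<in> {..CARD('s) * Q}. f t = s})" by auto
  then have "card {..CARD('s) * Q} = card (\<Union>s. {t \<in> {..CARD('s) * Q}. f t = s})" by simp
  also have "\<dots> \<le> (\<Sum>s\<in>UNIV. card {t \<in> {..CARD('s) * Q}. f t = s})"
    by (rule card_UN_le) simp
  also have "\<dots> \<le> (\<Sum>s\<in>(UNIV :: 's set). Q)"
    by (rule sum_mono) (rule le)
  finally show False by simp
qed

section \<open>One-step lookahead values of single actions\<close>

context finite_mdp
begin

text \<open>The Q-function with continuation \<open>v\<close>. Working action by action lets
  policies that differ in one state be compared there, which whole-policy operators obscure.\<close>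

definition action_value :: "real ^ 's \<Rightarrow> 's \<Rightarrow> 'a \<Rightarrow> real" where
  "action_value v i a = (\<Sum>j\<in>UNIV. p i j a * (r i a j + \<gamma> * v $ j))"

lemma T_pol_nth: "T_pol \<pi> v $ i = action_value v i (\<pi> i)"
  by (simp add: T_pol_def r_pol_def P_pol_def action_value_def matrix_vector_mult_def
      distrib_left sum.distrib sum_distrib_left mult_ac)

lemma action_value_diff:
  "action_value v i a - action_value w i a = \<gamma> * (\<Sum>j\<in>UNIV. p i j a * (v $ j - w $ j))"
  by (simp add: action_value_def sum_subtractf [symmetric] sum_distrib_left algebra_simps)

lemma action_value_mono:
  assumes "a \<in> A i" "\<And>j. v $ j \<le> w $ j"
  shows "action_value v i a \<le> action_value w i a"
proof -
  have "0 \<le> \<gamma> * (\<Sum>j\<in>UNIV. p i j a * (w $ j - v $ j))"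
    using assms discount by (intro mult_nonneg_nonneg sum_nonneg p_nonneg) auto
  then show ?thesis using action_value_diff [of w i a v] by simp
qed

lemma action_value_shift:
  assumes "a \<in> A i"
  shows "action_value (\<chi> j. v $ j + c) i a = action_value v i a + \<gamma> * c"
  using action_value_diff [of "\<chi> j. v $ j + c" i a v] p_sum [OF assms]
  by (simp add: sum_distrib_right [symmetric])

section \<open>Policy evaluation: existence, uniqueness and comparison of values\<close>

lemma policiesD: "\<pi> \<in> policies \<Longrightarrow> \<pi> i \<in> A i"
  by (simp add: policies_def)

text \<open>The minimum principle: evaluate the assumption at a state minimising \<open>d\<close>.\<close>

lemma nonneg_of_discounted_superharmonic:
  fixes d :: "'s \<Rightarrow> real"
  assumes "\<pi> \<in> policies" and d: "\<And>i. \<gamma> * (\<Sum>j\<in>UNIV. p i j (\<pi> i) * d j) \<le> d i"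
  shows "0 \<le> d i"
proof -
  obtain m where m: "\<And>j. d m \<le> d j"
    using ex_is_arg_min_if_finite [of "UNIV :: 's set" d] by (auto simp: is_arg_min_linorder)
  have "d m = (\<Sum>j\<in>UNIV. p m j (\<pi> m) * d m)"
    using p_sum [of "\<pi> m" m] policiesD [OF assms(1)] by (simp add: sum_distrib_right [symmetric])
  also have "\<dots> \<le> (\<Sum>j\<in>UNIV. p m j (\<pi> m) * d j)"
    by (intro sum_mono mult_left_mono m p_nonneg policiesD assms)
  finally have "\<gamma> * d m \<le> d m"
    using d [of m] discount by (meson mult_left_mono less_imp_le order_trans)
  then have "0 \<le> (1 - \<gamma>) * d m" by (simp add: algebra_simps)
  then have "0 \<le> d m" using discount by (simp add: zero_le_mult_iff)
  with m show ?thesis using order_trans by blast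
qed

text \<open>A supersolution minus the fixed point is discounted superharmonic, because the rewards
  cancel in the difference; so the minimum principle applies.\<close>

lemma fixed_point_le:
  assumes \<pi>: "\<pi> \<in> policies" and w: "T_pol \<pi> w = w"
    and v: "\<And>i. action_value v i (\<pi> i) \<le> v $ i"
  shows "w $ i \<le> v $ i"
proof -
  have "0 \<le> v $ i - w $ i"
  proof (rule nonneg_of_discounted_superharmonic [OF \<pi>])
    fix i
    have "w $ i = action_value w i (\<pi> i)" by (metis T_pol_nth w)
    then show "\<gamma> * (\<Sum>j\<in>UNIV. p i j (\<pi> i) * (v $ j - w $ j)) \<le> v $ i - w $ i"
      using v [of i] by (simp add: action_value_diff [symmetric])
  qed
  then show ?thesis by simp
qed

lemma fixed_point_ge:
  assumes \<pi>: "\<pi> \<in> policies" and w: "T_pol \<pi> w = w"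
    and v: "\<And>i. v $ i \<le> action_value v i (\<pi> i)"
  shows "v $ i \<le> w $ i"
proof -
  have "0 \<le> w $ i - v $ i"
  proof (rule nonneg_of_discounted_superharmonic [OF \<pi>])
    fix i
    have "w $ i = action_value w i (\<pi> i)" by (metis T_pol_nth w)
    then show "\<gamma> * (\<Sum>j\<in>UNIV. p i j (\<pi> i) * (w $ j - v $ j)) \<le> w $ i - v $ i"
      using v [of i] by (simp add: action_value_diff [symmetric])
  qed
  then show ?thesis by simp
qed

lemma T_pol_fixed_point_unique:
  assumes "\<pi> \<in> policies" "T_pol \<pi> v = v" "T_pol \<pi> w = w"
  shows "v = w"
proof -
  have "v $ i \<le> w $ i" for i
    by (rule fixed_point_le [OF assms(1,2)]) (simp add: T_pol_nth [symmetric] assms(3))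
  moreover have "w $ i \<le> v $ i" for i
    by (rule fixed_point_le [OF assms(1,3)]) (simp add: T_pol_nth [symmetric] assms(2))
  ultimately show ?thesis by (simp add: vec_eq_iff antisym)
qed

text \<open>Uniqueness for zero rewards makes \<open>I - \<gamma> P\<close> injective, hence surjective.\<close>

lemma T_pol_fixed_point_exists:
  assumes \<pi>: "\<pi> \<in> policies"
  shows "\<exists>v. T_pol \<pi> v = v"
proof -
  define f where "f v = v - \<gamma> *\<^sub>R (P_pol \<pi> *v v)" for v
  have lin: "linear f"
    unfolding f_def
    by (intro linear_compose_sub linear_ident linear_compose_scale_right matrix_vector_mul_linear)
  have sub: "0 \<le> v $ i" if "f v = 0" for v i
  proof (rule nonneg_of_discounted_superharmonic [OF \<pi>])
    fix i
    have "f v $ i = 0" using that by simp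
    then show "\<gamma> * (\<Sum>j\<in>UNIV. p i j (\<pi> i) * v $ j) \<le> v $ i"
      by (simp add: f_def P_pol_def matrix_vector_mult_def)
  qed
  have "inj f"
    unfolding linear_injective_0 [OF lin]
  proof (intro allI impI)
    fix v assume v: "f v = 0"
    then have "f (- v) = 0" using linear_neg [OF lin] by simp
    then show "v = 0" using sub [OF v] sub [of "- v"]
      by (simp add: vec_eq_iff) (meson antisym)
  qed
  then obtain v where "f v = r_pol \<pi>"
    using linear_injective_imp_surjective [OF lin] by (metis surj_def)
  then have "T_pol \<pi> v = v" by (simp add: T_pol_def f_def algebra_simps)
  then show ?thesis ..
qed

lemma T_pol_val:
  assumes "\<pi> \<in> policies"
  shows "T_pol \<pi> (val \<pi>) = val \<pi>"
proof -
  have "\<exists>!v. T_pol \<pi> v = v"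
    using T_pol_fixed_point_exists [OF assms] T_pol_fixed_point_unique [OF assms] by blast
  then show ?thesis unfolding val_def by (rule theI')
qed

lemma action_value_val: "\<pi> \<in> policies \<Longrightarrow> action_value (val \<pi>) i (\<pi> i) = val \<pi> $ i"
  using T_pol_nth [of \<pi> "val \<pi>" i] T_pol_val by simp

text \<open>The shift by \<open>c / (1 - \<gamma>)\<close> absorbs the error \<open>c\<close>
  exactly: lookahead discounts the shift, and
  \<open>c + \<gamma> * (c / (1 - \<gamma>)) = c / (1 - \<gamma>)\<close>. The shifted vector is
  thus a true supersolution.\<close>

lemma val_le:
  assumes \<pi>: "\<pi> \<in> policies" and v: "\<And>i. action_value v i (\<pi> i) \<le> v $ i + c"
  shows "val \<pi> $ i \<le> v $ i + c / (1 - \<gamma>)"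
proof -
  have *: "c + \<gamma> * (c / (1 - \<gamma>)) = c / (1 - \<gamma>)" using discount by (simp add: field_simps)
  have "val \<pi> $ i \<le> (\<chi> j. v $ j + c / (1 - \<gamma>)) $ i"
  proof (rule fixed_point_le [OF \<pi> T_pol_val [OF \<pi>]])
    show "action_value (\<chi> j. v $ j + c / (1 - \<gamma>)) i (\<pi> i) \<le> (\<chi> j. v $ j + c / (1 - \<gamma>)) $ i" for i
      using v [of i] * by (simp only: action_value_shift [OF policiesD [OF \<pi>]] vec_lambda_beta)
  qed
  then show ?thesis by simp
qed

lemma val_ge:
  assumes \<pi>: "\<pi> \<in> policies" and v: "\<And>i. v $ i \<le> action_value v i (\<pi> i) + c"
  shows "v $ i \<le> val \<pi> $ i + c / (1 - \<gamma>)"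
proof -
  have *: "- c + \<gamma> * (- (c / (1 - \<gamma>))) = - (c / (1 - \<gamma>))"
    using discount by (simp add: field_simps)
  have "(\<chi> j. v $ j + - (c / (1 - \<gamma>))) $ i \<le> val \<pi> $ i"
  proof (rule fixed_point_ge [OF \<pi> T_pol_val [OF \<pi>]])
    show "(\<chi> j. v $ j + - (c / (1 - \<gamma>))) $ i \<le> action_value (\<chi> j. v $ j + - (c / (1 - \<gamma>))) i (\<pi> i)" for i
      using v [of i] * by (simp only: action_value_shift [OF policiesD [OF \<pi>]] vec_lambda_beta)
  qed
  then show ?thesis by simp
qed

text \<open>A subsolution lies below \<open>val \<pi>\<close>; one more monotone lookahead step
  preserves this and fixes \<open>val \<pi>\<close>. Hence a switch gains at least its one-step
  improvement.\<close>

lemma val_ge_action_value: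
  assumes \<pi>: "\<pi> \<in> policies" and v: "\<And>i. v $ i \<le> action_value v i (\<pi> i)"
  shows "action_value v i (\<pi> i) \<le> val \<pi> $ i"
proof -
  have "v $ j \<le> val \<pi> $ j" for j
    using val_ge [OF \<pi>, of v 0] v by simp
  then show ?thesis
    using action_value_mono [OF policiesD [OF \<pi>], of v "val \<pi>" i] action_value_val [OF \<pi>] by simp
qed

section \<open>Existence of an optimal policy and the Bellman optimality inequality\<close>

lemma finite_policies: "finite policies"
proof -
  have "finite (A i)" for i using finite_Act A_union by (metis UN_upper UNIV_I finite_subset)
  then have "finite (Pi\<^sub>E UNIV A)" by (intro finite_PiE) auto
  then show ?thesis by (simp add: policies_def PiE_UNIV_domain Pi_def)
qed

lemma policies_nonempty: "policies \<noteq> {}"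
proof -
  have "(\<lambda>i. SOME a. a \<in> A i) \<in> policies"
    using A_nonempty by (simp add: policies_def some_in_eq)
  then show ?thesis by blast
qed

text \<open>Overriding an arbitrary policy at \<open>i\<close> turns any admissible action into part
  of a policy, so the maximum over policies dominates each action.\<close>

lemma action_value_le_T_opt:
  assumes "a \<in> A i"
  shows "action_value v i a \<le> T_opt v $ i"
proof -
  obtain \<pi> where \<pi>: "\<pi> \<in> policies" using policies_nonempty by blast
  then have "\<pi>(i := a) \<in> policies" using assms by (simp add: policies_def)
  then have "T_pol (\<pi>(i := a)) v $ i \<le> T_opt v $ i"
    unfolding T_opt_def using finite_policies by (auto intro!: Max_ge)
  then show ?thesis by (simp add: T_pol_nth)
qed

text \<open>Take a policy maximising the sum of its values. An improving action at one state would
  raise that component strictly and lower none, contradicting maximality.\<close>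

lemma ex_policy_without_improvement:
  "\<exists>\<pi>\<in>policies. \<forall>i. \<forall>a\<in>A i. action_value (val \<pi>) i a \<le> val \<pi> $ i"
proof -
  obtain \<pi> where \<pi>: "\<pi> \<in> policies"
    and max: "\<And>\<pi>'. \<pi>' \<in> policies \<Longrightarrow> (\<Sum>i\<in>UNIV. val \<pi>' $ i) \<le> (\<Sum>i\<in>UNIV. val \<pi> $ i)"
    using ex_is_arg_min_if_finite [OF finite_policies policies_nonempty,
        of "\<lambda>\<pi>. - (\<Sum>i\<in>UNIV. val \<pi> $ i)"]
    by (auto simp: is_arg_min_linorder)
  have "action_value (val \<pi>) i a \<le> val \<pi> $ i" if a: "a \<in> A i" for i a
  proof (rule ccontr)
    assume less: "\<not> ?thesis"
    define \<pi>' where "\<pi>' = \<pi>(i := a)"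
    have \<pi>': "\<pi>' \<in> policies" using \<pi> a by (simp add: \<pi>'_def policies_def)
    have le: "val \<pi> $ j \<le> action_value (val \<pi>) j (\<pi>' j)" for j
      using less action_value_val [OF \<pi>] by (simp add: \<pi>'_def)
    note ge = val_ge_action_value [OF \<pi>' le]
    have gain: "val \<pi> $ i < val \<pi>' $ i"
    proof -
      have "\<pi>' i = a" by (simp add: \<pi>'_def)
      then show ?thesis using ge [of i] less by simp
    qed
    have "(\<Sum>j\<in>UNIV. val \<pi> $ j) < (\<Sum>j\<in>UNIV. val \<pi>' $ j)"
    proof (rule sum_strict_mono_ex1)
      show "\<forall>j\<in>UNIV. val \<pi> $ j \<le> val \<pi>' $ j" using le ge order_trans by blast
      show "\<exists>j\<in>UNIV. val \<pi> $ j < val \<pi>' $ j" using gain by blast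
    qed simp
    with max [OF \<pi>'] show False by simp
  qed
  with \<pi> show ?thesis by blast
qed

text \<open>The value of a policy without improving actions is a supersolution for every policy, so
  it dominates all values in all states at once and the componentwise maximum is attained by one
  policy.\<close>

lemma ex_optimal_policy:
  "\<exists>\<pi>. optimal \<pi> \<and> (\<forall>i. \<forall>a\<in>A i. action_value opt_val i a \<le> opt_val $ i)"
proof -
  obtain \<pi> where \<pi>: "\<pi> \<in> policies"
    and no_impr: "\<And>i a. a \<in> A i \<Longrightarrow> action_value (val \<pi>) i a \<le> val \<pi> $ i"
    using ex_policy_without_improvement by blast
  have "val \<pi>' $ i \<le> val \<pi> $ i" if "\<pi>' \<in> policies" for \<pi>' i
    using val_le [OF that, of "val \<pi>" 0] no_impr policiesD [OF that] by simp
  then have "opt_val = val \<pi>"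
    unfolding opt_val_def vec_eq_iff using \<pi> finite_policies by (auto intro!: Max_eqI)
  with \<pi> no_impr show ?thesis unfolding optimal_def by auto
qed

lemma optimal_action_value_le: "a \<in> A i \<Longrightarrow> action_value opt_val i a \<le> opt_val $ i"
  using ex_optimal_policy by blast

lemma val_le_opt_val:
  assumes "\<pi> \<in> policies"
  shows "val \<pi> $ i \<le> opt_val $ i"
  using val_le [OF assms, of opt_val 0] optimal_action_value_le policiesD [OF assms] by simp

section \<open>Action gaps, progress of a switch, and elimination of actions\<close>

definition gap :: "'s \<Rightarrow> 'a \<Rightarrow> real" where
  "gap i a = opt_val $ i - action_value opt_val i a"

text \<open>Replacing \<open>opt_val\<close> by the smaller \<open>val \<pi>\<close> in the
  lookahead can only increase the loss, and the lookahead of \<open>\<pi>\<close> at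
  \<open>val \<pi>\<close> is \<open>val \<pi>\<close> itself.\<close>

lemma gap_le:
  assumes "\<pi> \<in> policies"
  shows "gap i (\<pi> i) \<le> opt_val $ i - val \<pi> $ i"
  unfolding gap_def
  using action_value_mono [OF policiesD, OF assms, of "val \<pi>" opt_val i] action_value_val [OF assms, of i]
    val_le_opt_val [OF assms] by simp

lemma opt_val_diff_le_gap:
  assumes "\<pi> \<in> policies" "\<And>i. gap i (\<pi> i) \<le> c"
  shows "(1 - \<gamma>) * (opt_val $ i - val \<pi> $ i) \<le> c"
proof -
  have "opt_val $ i \<le> val \<pi> $ i + c / (1 - \<gamma>)"
    by (rule val_ge [OF assms(1)]) (use assms(2) in \<open>simp add: gap_def algebra_simps\<close>)
  then show ?thesis using discount by (simp add: field_simps)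
qed

text \<open>The witness in the third claim is the switched state. There the full maximal advantage
  is gained, and that advantage bounds the one-step excess of an optimal policy over
  \<open>val \<pi>\<close> in every state, so \<open>val_le\<close> bounds every distance to the
  optimum.\<close>

lemma simplex_step_improvement:
  assumes \<pi>: "\<pi> \<in> policies" and step: "simplex_step \<pi> \<pi>'"
  shows "\<pi>' \<in> policies" and "val \<pi> $ i \<le> val \<pi>' $ i"
    and "\<exists>s. \<forall>i. (1 - \<gamma>) * (opt_val $ i - val \<pi> $ i) \<le> val \<pi>' $ s - val \<pi> $ s"
proof -
  obtain g s where g: "greedy g (val \<pi>)"
    and s: "\<And>j. advantage \<pi> $ j \<le> advantage \<pi> $ s"
    and \<pi>'_eq: "\<pi>' = switch g \<pi> {s}"
    using step unfolding simplex_step_def by (auto simp: is_arg_max_linorder)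
  show \<pi>': "\<pi>' \<in> policies"
    using g \<pi> by (auto simp: \<pi>'_eq switch_def greedy_def policies_def)
  have gs: "action_value (val \<pi>) s (\<pi>' s) = T_opt (val \<pi>) $ s"
    using g by (simp add: \<pi>'_eq switch_def greedy_def T_pol_nth [symmetric])
  have "val \<pi> $ s \<le> T_opt (val \<pi>) $ s"
    using action_value_le_T_opt [OF policiesD [OF \<pi>]] action_value_val [OF \<pi>] by metis
  then have le: "val \<pi> $ j \<le> action_value (val \<pi>) j (\<pi>' j)" for j
    using gs action_value_val [OF \<pi>] by (cases "j = s") (simp_all add: \<pi>'_eq switch_def)
  note ge = val_ge_action_value [OF \<pi>' le]
  show "val \<pi> $ i \<le> val \<pi>' $ i" using le ge order_trans by blast
  have gain: "advantage \<pi> $ s \<le> val \<pi>' $ s - val \<pi> $ s"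
    using ge [of s] gs by (simp add: advantage_def)
  obtain \<rho> where \<rho>: "\<rho> \<in> policies" "opt_val = val \<rho>"
    using ex_optimal_policy unfolding optimal_def by metis
  have "(1 - \<gamma>) * (opt_val $ i - val \<pi> $ i) \<le> advantage \<pi> $ s" for i
  proof -
    have "val \<rho> $ i \<le> val \<pi> $ i + advantage \<pi> $ s / (1 - \<gamma>)"
    proof (rule val_le [OF \<rho>(1)])
      show "action_value (val \<pi>) i (\<rho> i) \<le> val \<pi> $ i + advantage \<pi> $ s" for i
        using action_value_le_T_opt [OF policiesD [OF \<rho>(1)], of "val \<pi>" i] s [of i]
        by (simp add: advantage_def)
    qed
    then show ?thesis using discount \<rho>(2) by (simp add: field_simps)
  qed
  then show "\<exists>s. \<forall>i. (1 - \<gamma>) * (opt_val $ i - val \<pi> $ i) \<le> val \<pi>' $ s - val \<pi> $ s"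
    using gain order_trans by blast
qed

lemma max_distance_contraction:
  assumes \<pi>s: "\<And>k. k \<le> CARD('s) * Q \<Longrightarrow> \<pi>s k \<in> policies"
    and step: "\<And>k. k \<le> CARD('s) * Q \<Longrightarrow> simplex_step (\<pi>s k) (\<pi>s (Suc k))"
    and c: "\<And>i. opt_val $ i - val (\<pi>s 0) $ i \<le> c"
  shows "(1 - \<gamma>) * (opt_val $ i - val (\<pi>s (CARD('s) * Q)) $ i) \<le> \<gamma> ^ Q * c"
proof -
  let ?W = "CARD('s) * Q"
  define \<Delta> where "\<Delta> k i = opt_val $ i - val (\<pi>s k) $ i" for k i
  have "\<forall>k. \<exists>s. k \<le> ?W \<longrightarrow> (\<forall>i. (1 - \<gamma>) * \<Delta> k i \<le> \<Delta> k s - \<Delta> (Suc k) s)"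
    using simplex_step_improvement(3) [OF \<pi>s step] by (fastforce simp: \<Delta>_def)
  \<comment> \<open>\<open>f k\<close> is a state witnessing the progress of step \<open>k\<close>;
    one state serves all \<open>i\<close>.\<close>
  then obtain f where f: "\<And>k i. k \<le> ?W \<Longrightarrow> (1 - \<gamma>) * \<Delta> k i \<le> \<Delta> k (f k) - \<Delta> (Suc k) (f k)"
    by metis
  have dec: "\<Delta> (Suc k) i \<le> \<Delta> k i" if "k \<le> ?W" for k i
    using simplex_step_improvement(2) [OF \<pi>s step, OF that that] by (simp add: \<Delta>_def)
  have nonneg: "0 \<le> \<Delta> k i" if "k \<le> ?W" for k i
    using val_le_opt_val [OF \<pi>s [OF that]] by (simp add: \<Delta>_def)
  have count: "\<Delta> k s \<le> \<gamma> ^ card {t \<in> {..<k}. f t = s} * \<Delta> 0 s" if "k \<le> ?W" for k s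
    using that
  proof (induction k)
    case (Suc k)
    show ?case
    proof (cases "f k = s")
      case True
      have "{t \<in> {..<Suc k}. f t = s} = insert k {t \<in> {..<k}. f t = s}"
        using True by (auto simp: less_Suc_eq)
      then have card: "card {t \<in> {..<Suc k}. f t = s} = Suc (card {t \<in> {..<k}. f t = s})" by simp
      \<comment> \<open>This is the progress inequality at \<open>i = s\<close>, rearranged.\<close>
      have "\<Delta> (Suc k) s \<le> \<gamma> * \<Delta> k s"
        using f [of k s] Suc.prems True by (simp add: algebra_simps)
      also have "\<dots> \<le> \<gamma> * (\<gamma> ^ card {t \<in> {..<k}. f t = s} * \<Delta> 0 s)"
        using Suc discount by (intro mult_left_mono) auto
      finally show ?thesis by (simp only: card power_Suc mult.assoc)
    next
      case False
      then have "{t \<in> {..<Suc k}. f t = s} = {t \<in> {..<k}. f t = s}"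
        by (auto simp: less_Suc_eq)
      then show ?thesis using Suc dec [of k s] by fastforce
    qed
  qed simp
  obtain s where s: "Q < card {t \<in> {..?W}. f t = s}"
    using ex_frequent_value by blast
  \<comment> \<open>The last occurrence of the frequent state \<open>s\<close>. Of its at least
    \<open>Q + 1\<close> occurrences, at least \<open>Q\<close> come before \<open>K\<close> and
    contract the distance at \<open>s\<close>; the one at \<open>K\<close> transfers the bound from
    \<open>s\<close> to all states.\<close>
  define K where "K = Max {t \<in> {..?W}. f t = s}"
  have "{t \<in> {..?W}. f t = s} \<noteq> {}" using s by (metis card.empty not_less0)
  then have K: "K \<in> {t \<in> {..?W}. f t = s}" unfolding K_def by (intro Max_in) auto
  have "t \<le> K" if "t \<in> {t \<in> {..?W}. f t = s}" for t
    unfolding K_def using that by (intro Max_ge) auto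
  then have "{t \<in> {..?W}. f t = s} \<subseteq> insert K {t \<in> {..<K}. f t = s}"
    by (auto simp: le_less)
  then have "card {t \<in> {..?W}. f t = s} \<le> card (insert K {t \<in> {..<K}. f t = s})"
    by (intro card_mono) auto
  then have Q: "Q \<le> card {t \<in> {..<K}. f t = s}" using s by simp
  have mono: "\<Delta> l i \<le> \<Delta> K i" if "K \<le> l" "l \<le> ?W" for l
    using that
  proof (induction l rule: dec_induct)
    case (step l)
    then show ?case using dec [of l i] by simp
  qed simp
  have "(1 - \<gamma>) * \<Delta> ?W i \<le> (1 - \<gamma>) * \<Delta> K i"
    using K mono [of ?W] discount by (intro mult_left_mono) auto
  \<comment> \<open>The progress at \<open>K\<close> is at most the remaining distance at
    \<open>s\<close>, since the distance after the step is nonnegative. If \<open>K\<close> is the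
    end of the window, \<open>Suc K\<close> lies outside it, so that policy is admissible by the
    step itself.\<close>
  also have "\<dots> \<le> \<Delta> K s"
    using f [of K i] K dec [of K s] nonneg [of K] simplex_step_improvement(1) [OF \<pi>s step, of K]
      val_le_opt_val [of "\<pi>s (Suc K)" s]
    by (auto simp: \<Delta>_def)
  also have "\<dots> \<le> \<gamma> ^ card {t \<in> {..<K}. f t = s} * \<Delta> 0 s"
    using K by (intro count) auto
  also have "\<dots> \<le> \<gamma> ^ Q * \<Delta> 0 s"
    using nonneg [of 0 s] Q discount by (intro mult_right_mono power_decreasing) auto
  also have "\<dots> \<le> \<gamma> ^ Q * c"
    using c discount by (intro mult_left_mono) (auto simp: \<Delta>_def)
  finally show ?thesis by (simp add: \<Delta>_def)
qed

text \<open>Otherwise, sampling every \<open>CARD('s) * Q\<close> steps and recording an action of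
  largest gap each time gives \<open>card Act - CARD('s) + 1\<close> distinct actions, all of them
  avoided by a fixed optimal policy.\<close>

lemma exists_optimal_within:
  assumes run: "simplex_PI_run \<pi>s" and Q: "\<gamma> ^ Q < (1 - \<gamma>)\<^sup>2"
  shows "optimal (\<pi>s ((card Act - CARD('s)) * (CARD('s) * Q)))"
proof (rule ccontr)
  let ?W = "CARD('s) * Q" and ?M = "card Act - CARD('s)"
  assume nonopt: "\<not> optimal (\<pi>s (?M * ?W))"
  have stay: "optimal (\<pi>s l)" if "optimal (\<pi>s k)" "k \<le> l" for k l
    using that(2) by (induction l rule: dec_induct) (use run that(1) in \<open>auto simp: simplex_PI_run_def\<close>)
  have no: "\<not> optimal (\<pi>s k)" if "k \<le> ?M * ?W" for k
    using stay nonopt that by blast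
  \<comment> \<open>The endpoint is included: the policy there is not optimal either, so a genuine
    step leaves it. The last window needs this extra step.\<close>
  have simplex: "simplex_step (\<pi>s k) (\<pi>s (Suc k))" if "k \<le> ?M * ?W" for k
    using run no [OF that] by (auto simp: simplex_PI_run_def)
  have pol: "\<pi>s k \<in> policies" for k
  proof (induction k)
    case (Suc k)
    have "if optimal (\<pi>s k) then \<pi>s (Suc k) = \<pi>s k else simplex_step (\<pi>s k) (\<pi>s (Suc k))"
      using run unfolding simplex_PI_run_def by blast
    then show ?case using Suc simplex_step_improvement(1) by (auto split: if_splits)
  qed (use run in \<open>simp add: simplex_PI_run_def\<close>)
  have mono: "val (\<pi>s k) $ i \<le> val (\<pi>s l) $ i" if "k \<le> l" "l \<le> ?M * ?W" for k l i
    using that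
  proof (induction l rule: dec_induct)
    case (step l)
    then show ?case using simplex_step_improvement(2) [OF pol simplex, of l i] by simp
  qed simp
  have "\<exists>s. \<forall>i. gap i (\<pi>s k i) \<le> gap s (\<pi>s k s)" for k
    using ex_is_arg_min_if_finite [of "UNIV :: 's set" "\<lambda>i. - gap i (\<pi>s k i)"]
    by (auto simp: is_arg_min_linorder)
  then obtain s where s: "\<And>k i. gap i (\<pi>s k i) \<le> gap (s k) (\<pi>s k (s k))" by metis
  define c where "c k = gap (s k) (\<pi>s k (s k))" for k
  have dist: "(1 - \<gamma>) * (opt_val $ i - val (\<pi>s k) $ i) \<le> c k" for k i
    unfolding c_def by (rule opt_val_diff_le_gap [OF pol s])
  \<comment> \<open>If no gap were positive, \<open>dist\<close> would force the value to be
    optimal.\<close>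
  have c_pos: "0 < c k" if "k \<le> ?M * ?W" for k
  proof (rule ccontr)
    assume "\<not> ?thesis"
    then have "(1 - \<gamma>) * (opt_val $ i - val (\<pi>s k) $ i) \<le> 0" for i
      using dist [of i k] by simp
    then have "opt_val $ i \<le> val (\<pi>s k) $ i" for i
      using discount by (simp add: mult_le_0_iff)
    then have "val (\<pi>s k) = opt_val"
      using val_le_opt_val [OF pol] by (simp add: vec_eq_iff antisym)
    with no [OF that] pol show False by (simp add: optimal_def)
  qed
  obtain \<rho> where \<rho>: "\<rho> \<in> policies" "opt_val = val \<rho>"
    using ex_optimal_policy unfolding optimal_def by metis
  define b where "b j = \<pi>s (j * ?W) (s (j * ?W))" for j
  \<comment> \<open>By disjointness an action determines its state, so equal samples
    \<open>b j\<close> and \<open>b l\<close> have equal states and equal gaps.\<close>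
  have state_eq: "i = j" if "a \<in> A i" "a \<in> A j" for a i j
    using A_disjoint that unfolding disjoint_family_on_def by blast
  have bA: "b j \<in> A (s (j * ?W))" for j
    unfolding b_def by (rule policiesD [OF pol])
  have neq: "b j \<noteq> b l" if "j < l" "l \<le> ?M" for j l
  proof
    assume eq: "b j = b l"
    let ?k = "j * ?W" and ?l = "l * ?W"
    let ?s = "s ?k"
    have "s ?l = ?s" using state_eq [OF bA [of l]] bA [of j] eq by simp
    then have "c ?k = gap ?s (\<pi>s ?l ?s)"
      using eq by (simp add: c_def b_def)
    also have "\<dots> \<le> opt_val $ ?s - val (\<pi>s ?l) $ ?s" by (rule gap_le [OF pol])
    finally have 1: "c ?k \<le> opt_val $ ?s - val (\<pi>s ?l) $ ?s" .
    have "Suc j * ?W \<le> l * ?W" using that by (intro mult_right_mono) auto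
    then have jl: "?k + ?W \<le> ?l" by simp
    have lM: "?l \<le> ?M * ?W" using that by (intro mult_right_mono) auto
    \<comment> \<open>One factor \<open>1 / (1 - \<gamma>)\<close> comes from bounding distances by
      the largest gap, another from the contraction over the window. With \<open>1\<close> they give
      \<open>(1 - \<gamma>)\<^sup>2 * c ?k \<le> \<gamma> ^ Q * c ?k\<close>, against the choice of
      \<open>Q\<close>.\<close>
    have "(1 - \<gamma>) * (opt_val $ ?s - val (\<pi>s (?k + ?W)) $ ?s) \<le> \<gamma> ^ Q * (c ?k / (1 - \<gamma>))"
    proof (rule max_distance_contraction [where \<pi>s = "\<lambda>t. \<pi>s (?k + t)"])
      show "simplex_step (\<pi>s (?k + t)) (\<pi>s (?k + Suc t))" if "t \<le> ?W" for t
        using simplex [of "?k + t"] that jl lM by simp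
      show "opt_val $ i - val (\<pi>s (?k + 0)) $ i \<le> c ?k / (1 - \<gamma>)" for i
        using dist [of i ?k] discount by (simp add: field_simps)
    qed (rule pol)
    moreover have "(1 - \<gamma>) * c ?k \<le> (1 - \<gamma>) * (opt_val $ ?s - val (\<pi>s (?k + ?W)) $ ?s)"
      using 1 mono [OF jl lM, of ?s] discount by (intro mult_left_mono) auto
    ultimately have "(1 - \<gamma>) * c ?k \<le> \<gamma> ^ Q * c ?k / (1 - \<gamma>)" by simp
    then have "(1 - \<gamma>)\<^sup>2 * c ?k \<le> \<gamma> ^ Q * c ?k"
      using discount by (simp add: pos_le_divide_eq power2_eq_square mult_ac)
    moreover have "0 < c ?k" by (rule c_pos) (use jl lM in linarith)
    ultimately show False using Q by simp
  qed
  have inj: "inj_on b {..?M}"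
    by (rule linorder_inj_onI) (use neq in auto)
  \<comment> \<open>The actions of the optimal \<open>\<rho>\<close> have gap 0 because
    \<open>opt_val\<close> is its fixed point, whereas the sampled gaps are positive.\<close>
  have "b ` {..?M} \<subseteq> Act - range \<rho>"
  proof
    fix a assume "a \<in> b ` {..?M}"
    then obtain j where j: "j \<le> ?M" "a = b j" by auto
    let ?k = "j * ?W"
    have "?k \<le> ?M * ?W" using j by (intro mult_right_mono) auto
    then have pos: "0 < gap (s ?k) a" using c_pos [of ?k] j by (simp add: c_def b_def)
    have "a \<noteq> \<rho> i" for i
    proof
      assume eq: "a = \<rho> i"
      then have "i = s ?k" using state_eq [OF policiesD [OF \<rho>(1), of i]] bA [of j] j by simp
      then have "gap (s ?k) a = 0"
        using eq action_value_val [OF \<rho>(1)] \<rho>(2) by (simp add: gap_def)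
      with pos show False by simp
    qed
    moreover have "a \<in> Act" using bA j A_union by blast
    ultimately show "a \<in> Act - range \<rho>" by auto
  qed
  then have "card {..?M} \<le> card (Act - range \<rho>)"
    using inj finite_Act by (intro card_inj_on_le) auto
  moreover have "inj \<rho>"
  proof (rule injI)
    fix i j assume "\<rho> i = \<rho> j"
    then show "i = j" using state_eq [of "\<rho> i" i j] policiesD [OF \<rho>(1), of j] policiesD [OF \<rho>(1), of i]
      by simp
  qed
  then have "card (range \<rho>) = CARD('s)" by (rule card_image)
  moreover have "range \<rho> \<subseteq> Act" using policiesD [OF \<rho>(1)] A_union by blast
  ultimately show False by (simp add: card_Diff_subset)
qed

section \<open>The explicit iteration bound\<close>

lemma card_states_le: "CARD('s) \<le> card Act"
proof -
  obtain \<rho> where "\<rho> \<in> policies" using policies_nonempty by blast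
  then have \<rho>: "\<rho> i \<in> A i" for i by (rule policiesD)
  then have "inj \<rho>"
    using A_disjoint unfolding disjoint_family_on_def by (intro injI) (metis disjoint_iff UNIV_I)
  moreover have "range \<rho> \<subseteq> Act" using \<rho> A_union by blast
  ultimately show ?thesis using card_inj_on_le [OF _ _ finite_Act] by blast
qed

lemma simplex_PI_iterations:
  assumes "simplex_PI_run \<pi>s"
  shows "terminates \<pi>s" and "real (iterations \<pi>s) \<le> simplex_PI_bound CARD('s) (card Act) \<gamma>"
proof -
  define C where "C = 2 / (1 - \<gamma>) * ln (1 / (1 - \<gamma>))"
  \<comment> \<open>Rounding \<open>C\<close> up costs at most 1, the source of the summand 1 in the
    bound.\<close>
  define Q where "Q = nat \<lceil>C\<rceil>"
  have "0 < ln (1 / (1 - \<gamma>))" using discount by (intro ln_gt_zero) simp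
  then have C: "0 < C" unfolding C_def using discount by (intro mult_pos_pos) auto
  have QC: "C \<le> real Q" "real Q \<le> 1 + C" unfolding Q_def using C by linarith+
  have "\<gamma> ^ Q = exp (real Q * ln \<gamma>)"
    using discount by (simp add: exp_of_nat_mult)
  also have "\<dots> \<le> exp (C * ln \<gamma>)"
    using QC discount by (simp add: mult_right_mono_neg)
  \<comment> \<open>Strict because \<open>ln \<gamma> = \<gamma> - 1\<close> only at
    \<open>\<gamma> = 1\<close>. The constant \<open>C\<close> is chosen so that the right side is
    exactly \<open>(1 - \<gamma>)\<^sup>2\<close>.\<close>
  also have "\<dots> < exp (C * (\<gamma> - 1))"
    using C discount ln_le_minus_one [of \<gamma>] ln_eq_minus_one [of \<gamma>] by (force simp: less_le)
  also have "C * (\<gamma> - 1) = 2 * ln (1 - \<gamma>)"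
    unfolding C_def using discount by (simp add: ln_div divide_simps) (simp add: algebra_simps)
  also have "exp (2 * ln (1 - \<gamma>)) = (1 - \<gamma>)\<^sup>2"
    using discount by (simp add: exp_double)
  finally have opt: "optimal (\<pi>s ((card Act - CARD('s)) * (CARD('s) * Q)))"
    by (rule exists_optimal_within [OF assms])
  then show "terminates \<pi>s" unfolding terminates_def by blast
  have "iterations \<pi>s \<le> (card Act - CARD('s)) * (CARD('s) * Q)"
    unfolding iterations_def using opt by (rule Least_le)
  then have "real (iterations \<pi>s) \<le> real ((card Act - CARD('s)) * (CARD('s) * Q))"
    by (rule of_nat_mono)
  \<comment> \<open>Truncated subtraction agrees with real subtraction by
    \<open>card_states_le\<close>.\<close>
  also have "\<dots> = real CARD('s) * (real (card Act) - real CARD('s)) * real Q"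
    using card_states_le by (simp add: of_nat_diff)
  also have "\<dots> \<le> real CARD('s) * (real (card Act) - real CARD('s)) * (1 + C)"
    using QC card_states_le by (intro mult_left_mono) auto
  finally show "real (iterations \<pi>s) \<le> simplex_PI_bound CARD('s) (card Act) \<gamma>"
    by (simp add: simplex_PI_bound_def C_def)
qed

end

section \<open>The uniform asymptotic bound\<close>

lemma simplex_PI_bound_bigo:
  assumes "0 < \<gamma>0" "\<gamma>0 < 1"
  shows "(\<lambda>(n, m, \<delta>). simplex_PI_bound n m \<delta>)
    \<in> O[principal (mdp_sizes \<gamma>0)](\<lambda>(n, m, \<delta>). real m * real n / (1 - \<delta>) * ln (1 / (1 - \<delta>)))"
proof (rule bigoI)
  \<comment> \<open>\<open>L\<close> is a positive lower bound for \<open>x\<close> below, uniform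
    over the domain. Hence \<open>1 \<le> x / L\<close>, which absorbs the summand 1 and yields the
    constant \<open>1 / L + 2\<close>.\<close>
  define L where "L = ln (1 / (1 - \<gamma>0))"
  have L: "0 < L" unfolding L_def using assms by (simp add: ln_div)
  have "norm (simplex_PI_bound n m \<delta>)
      \<le> (1 / L + 2) * norm (real m * real n / (1 - \<delta>) * ln (1 / (1 - \<delta>)))"
    if "(n, m, \<delta>) \<in> mdp_sizes \<gamma>0" for n m \<delta>
  proof -
    have nm: "n \<le> m" and \<delta>: "\<gamma>0 \<le> \<delta>" "\<delta> < 1" using that by (auto simp: mdp_sizes_def)
    define x where "x = ln (1 / (1 - \<delta>)) / (1 - \<delta>)"
    have "L \<le> ln (1 / (1 - \<delta>))"
      unfolding L_def using assms \<delta> by (simp add: ln_div)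
    also have "\<dots> \<le> x"
      using \<delta> assms by (simp add: x_def ln_div field_simps mult_le_0_iff)
    finally have x: "L \<le> x" .
    then have "1 \<le> x / L" using L by simp
    then have le: "1 + 2 * x \<le> (1 / L + 2) * x" by (simp add: algebra_simps)
    have x0: "0 \<le> x" using x L by simp
    have "simplex_PI_bound n m \<delta> = real n * (real m - real n) * (1 + 2 * x)"
      by (simp add: simplex_PI_bound_def x_def)
    moreover have "0 \<le> real n * (real m - real n) * (1 + 2 * x)"
      using nm x0 by simp
    moreover have "real n * (real m - real n) * (1 + 2 * x) \<le> (real m * real n) * ((1 / L + 2) * x)"
    proof (rule mult_mono)
      show "real n * (real m - real n) \<le> real m * real n"
        using nm by (simp add: algebra_simps)
    qed (use le x0 in auto)
    moreover have "real m * real n / (1 - \<delta>) * ln (1 / (1 - \<delta>)) = real m * real n * x"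
      by (simp add: x_def)
    ultimately show ?thesis using x0 by (simp add: abs_mult mult_ac)
  qed
  then show "\<forall>\<^sub>F x in principal (mdp_sizes \<gamma>0). norm (case x of (n, m, \<delta>) \<Rightarrow> simplex_PI_bound n m \<delta>)
      \<le> (1 / L + 2) * norm (case x of (n, m, \<delta>) \<Rightarrow> real m * real n / (1 - \<delta>) * ln (1 / (1 - \<delta>)))"
    unfolding eventually_principal by auto
qed

theorem theorem4:
  fixes Act :: "'a set"
    and A :: "'s::finite \<Rightarrow> 'a set"
    and p :: "'s \<Rightarrow> 's \<Rightarrow> 'a \<Rightarrow> real"
    and r :: "'s \<Rightarrow> 'a \<Rightarrow> 's \<Rightarrow> real"
    and \<gamma> :: real
  assumes mdp: "finite_mdp Act A p \<gamma>"
  shows "(\<forall>\<pi>s. finite_mdp.simplex_PI_run A p r \<gamma> \<pi>s \<longrightarrow>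
           finite_mdp.terminates A p r \<gamma> \<pi>s \<and>
           real (finite_mdp.iterations A p r \<gamma> \<pi>s) \<le> simplex_PI_bound CARD('s) (card Act) \<gamma>) \<and>
         (\<forall>\<gamma>0. 0 < \<gamma>0 \<and> \<gamma>0 < 1 \<longrightarrow>
           (\<lambda>(n, m, \<delta>). simplex_PI_bound n m \<delta>)
             \<in> O[principal (mdp_sizes \<gamma>0)](\<lambda>(n, m, \<delta>). real m * real n / (1 - \<delta>) * ln (1 / (1 - \<delta>))))"
proof -
  interpret finite_mdp Act A p r \<gamma> by (rule mdp)
  show ?thesis using simplex_PI_iterations simplex_PI_bound_bigo by blast
qed

end
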